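(* For $n \ge 3$, the cycle $C_n$ is $\gamma_{\rm tg}$-critical if and only if $n \pmod 6 \in \{0,1,3\}$.
   Context: Total domination game on a graph $G$ (without isolated vertices): two players, Dominator and Staller, alternately choose vertices of $G$; a chosen vertex must totally dominate (i.e., be adjacent to) at least one vertex not yet totally dominated by previously chosen vertices (a legal move); the game ends when no legal move exists. Dominator wants to minimize and Staller to maximize the number of moves. $\gamma_{\rm tg}(G)$ is the number of moves when Dominator moves first and both play optimally. For a vertex $v$, $G|v$ denotes the partially total dominated graph in which $v$ is declared already totally dominated (it need not be totally dominated during the game, and a move is legal only if it totally dominates some vertex that is not yet totally dominated and not declared so); $\gamma_{\rm tg}(G|v)$ is the number of moves in the Dominator-start game on $G|v$ under optimal play. $G$ is $\gamma_{\rm tg}$-critical if $\gamma_{\rm tg}(G|v) < \gamma_{\rm tg}(G)$ for every $v \in V(G)$. *)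

theory Defs
  imports Main
begin

text \<open>A (simple) graph is given by a finite vertex set V and an adjacency relation E
  (assumed symmetric and irreflexive where relevant).  The open neighbourhood of v:\<close>
definition open_nbhd :: "'a set \<Rightarrow> ('a \<Rightarrow> 'a \<Rightarrow> bool) \<Rightarrow> 'a \<Rightarrow> 'a set" where
  "open_nbhd V E v = {u \<in> V. E v u}"

text \<open>Legal moves when the vertices in D are already (or declared) totally dominated:
  a vertex is legal iff it totally dominates some vertex not in D.\<close>
definition legal_moves :: "'a set \<Rightarrow> ('a \<Rightarrow> 'a \<Rightarrow> bool) \<Rightarrow> 'a set \<Rightarrow> 'a set" where
  "legal_moves V E D = {v \<in> V. \<not> open_nbhd V E v \<subseteq> D}"

text \<open>Minimax value (number of remaining moves under optimal play) of the total
  domination game from state D, with Dominator to move iff domi.  The first argument is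
  a fuel bound; every legal move enlarges D \<inter> V, so fuel card V is always sufficient.\<close>
fun tg_value :: "nat \<Rightarrow> 'a set \<Rightarrow> ('a \<Rightarrow> 'a \<Rightarrow> bool) \<Rightarrow> bool \<Rightarrow> 'a set \<Rightarrow> nat" where
  "tg_value 0 V E domi D = 0"
| "tg_value (Suc k) V E domi D =
     (let M = legal_moves V E D in
      if M = {} then 0
      else if domi then Min ((\<lambda>v. Suc (tg_value k V E False (D \<union> open_nbhd V E v))) ` M)
      else Max ((\<lambda>v. Suc (tg_value k V E True (D \<union> open_nbhd V E v))) ` M))"

definition gamma_tg :: "'a set \<Rightarrow> ('a \<Rightarrow> 'a \<Rightarrow> bool) \<Rightarrow> nat" where
  "gamma_tg V E = tg_value (card V) V E True {}"

definition gamma_tg_pd :: "'a set \<Rightarrow> ('a \<Rightarrow> 'a \<Rightarrow> bool) \<Rightarrow> 'a \<Rightarrow> nat" where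
  "gamma_tg_pd V E v = tg_value (card V) V E True {v}"

definition tg_critical :: "'a set \<Rightarrow> ('a \<Rightarrow> 'a \<Rightarrow> bool) \<Rightarrow> bool" where
  "tg_critical V E \<longleftrightarrow> (\<forall>v\<in>V. gamma_tg_pd V E v < gamma_tg V E)"

definition cycle_adj :: "nat \<Rightarrow> nat \<Rightarrow> nat \<Rightarrow> bool" where
  "cycle_adj n i j \<longleftrightarrow> i < n \<and> j < n \<and> (j = (i + 1) mod n \<or> i = (j + 1) mod n)"

end

theory Submission
  imports Defs
begin

text \<open>
  Choosing the vertex \<open>x + 1\<close> of \<open>C\<^sub>n\<close> totally dominates \<open>x\<close> and \<open>x + 2\<close>. So the game takes place on
  the orbits of the shift \<open>x \<mapsto> x + 2\<close> (one orbit if \<open>n\<close> is odd, two if \<open>n\<close> is even): a move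
  removes two consecutive points of an orbit, at least one of which must still be there. The
  remaining points form runs, apart from orbits that are still complete (fresh).

  Staller wants to remove one point at a time, and can do so at the end of any run; only when all
  that remains is fresh must Staller remove two. Dominator removes two points at the end of
  a run of length at least two, so that only Staller increases the number of runs, and only by removing
  two points. With \<open>T\<close> points and \<open>K\<close> runs and fresh orbits left, Dominator to move, this bounds
  the number of remaining moves by \<open>\<lfloor>(2T + K)/3\<rfloor>\<close>. While one fresh orbit is left, whether Staller
  will be forced to open it depends on the residue modulo 3 of the number of points outside it, and
  tracking this residue makes the bounds of both players tight.
\<close>

section \<open>Arithmetic modulo 3\<close>

lemma mod3_Suc:
  fixes m :: nat
  shows "Suc m mod 3 = 0 \<longleftrightarrow> m mod 3 = 2"
    "Suc m mod 3 = Suc 0 \<longleftrightarrow> m mod 3 = 0"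
    "Suc m mod 3 = 2 \<longleftrightarrow> m mod 3 = Suc 0"
  by presburger+

text \<open>These quotients turn out to be the game values for a single orbit of n points, with and
  without a declared point. The numerators differ by 2, so the quotients agree exactly when 3
  divides \<open>2 * n - 1\<close>.\<close>

lemma thirds_less_iff:
  fixes n :: nat
  assumes "n > 0"
  shows "(2 * n - 1) div 3 < (2 * n + 1) div 3 \<longleftrightarrow> n mod 3 \<noteq> 2"
proof -
  define q r where "q = n div 3" and "r = n mod 3"
  have n: "n = 3 * q + r" and "r < 3" by (simp_all add: q_def r_def)
  then consider "r = 0" | "r = 1" | "r = 2" by linarith
  then show ?thesis
  proof cases
    case 1
    have "(2 * n - 1) div 3 = 2 * q - 1" "(2 * n + 1) div 3 = 2 * q" using n 1 by linarith+
    then show ?thesis using assms n 1 r_def by simp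
  next
    case 2
    have "(2 * n - 1) div 3 = 2 * q" "(2 * n + 1) div 3 = 2 * q + 1" using n 2 by linarith+
    then show ?thesis using 2 r_def by simp
  next
    case 3
    have "(2 * n - 1) div 3 = 2 * q + 1" "(2 * n + 1) div 3 = 2 * q + 1" using n 3 by linarith+
    then show ?thesis using 3 r_def by simp
  qed
qed

text \<open>For the cycle, \<sigma> is the shift by 2. Moves enter only as the family of open
  neighbourhoods, so that vertices sharing a neighbourhood, as in \<open>C_4\<close>, need no
  separate treatment. By \<open>orb_min\<close> every orbit of \<sigma> is in \<open>Orbs\<close>: a
  member inside an orbit is nonempty and invariant, hence the whole orbit.\<close>

locale orbit_game =
  fixes V :: "'a set" and E :: "'a \<Rightarrow> 'a \<Rightarrow> bool" and \<sigma> :: "'a \<Rightarrow> 'a" and Orbs :: "'a set set"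
  assumes finite_V: "finite V"
    and bij: "bij_betw \<sigma> V V"
    and no_fix: "x \<in> V \<Longrightarrow> \<sigma> x \<noteq> x"
    and nbhds: "open_nbhd V E ` V = (\<lambda>x. {x, \<sigma> x}) ` V"
    and orb_sub: "A \<in> Orbs \<Longrightarrow> A \<subseteq> V"
    and orb_ne: "A \<in> Orbs \<Longrightarrow> A \<noteq> {}"
    and orb_inv: "A \<in> Orbs \<Longrightarrow> x \<in> V \<Longrightarrow> \<sigma> x \<in> A \<longleftrightarrow> x \<in> A"
    and orb_min: "W \<subseteq> V \<Longrightarrow> W \<noteq> {} \<Longrightarrow> \<sigma> ` W = W \<Longrightarrow> \<exists>A\<in>Orbs. A \<subseteq> W"
begin

section \<open>Moves as removals of points, and bounds on the game value\<close>

lemma sigma_V: "x \<in> V \<Longrightarrow> \<sigma> x \<in> V"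
  using bij by (auto simp: bij_betw_def)

lemma sigma_inj: "x \<in> V \<Longrightarrow> y \<in> V \<Longrightarrow> \<sigma> x = \<sigma> y \<longleftrightarrow> x = y"
  using bij by (auto simp: bij_betw_def inj_on_def)

lemma sigma_pre: assumes "x \<in> V" obtains z where "z \<in> V" "\<sigma> z = x"
  using bij assms by (metis bij_betw_imp_surj_on imageE)

text \<open>States are given by the set \<open>U\<close> of vertices not yet totally dominated, the complement of the
  state argument of \<^const>\<open>tg_value\<close>. A move is named by the point \<open>x\<close> for which it totally dominates
  \<open>x\<close> and \<open>\<sigma> x\<close>, not by the chosen vertex.\<close>

definition take2 :: "'a \<Rightarrow> 'a set \<Rightarrow> 'a set" where
  "take2 x U = U - {x, \<sigma> x}"

definition legal :: "'a \<Rightarrow> 'a set \<Rightarrow> bool" where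
  "legal x U \<longleftrightarrow> x \<in> V \<and> (x \<in> U \<or> \<sigma> x \<in> U)"

text \<open>Exhausted fuel yields 0, which is harmless for an upper bound, so \<open>ub\<close>
  ranges over all fuels. In contrast \<open>lb\<close> starts at fuel \<open>card U\<close>, which
  suffices because each legal move removes a point.\<close>

definition ub :: "bool \<Rightarrow> 'a set \<Rightarrow> nat \<Rightarrow> bool" where
  "ub d U b \<longleftrightarrow> (\<forall>k. tg_value k V E d (V - U) \<le> b)"

definition lb :: "bool \<Rightarrow> 'a set \<Rightarrow> nat \<Rightarrow> bool" where
  "lb d U b \<longleftrightarrow> (\<forall>k\<ge>card U. b \<le> tg_value k V E d (V - U))"

text \<open>A run that is not a complete orbit has exactly one last point, so the cardinality counts
  these runs. Complete orbits have no end and are recorded by \<open>fresh\<close>.\<close>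

definition ends :: "'a set \<Rightarrow> 'a set" where
  "ends U = {x \<in> U. \<sigma> x \<notin> U}"

definition fresh :: "'a set \<Rightarrow> 'a set set" where
  "fresh U = {A \<in> Orbs. A \<subseteq> U}"

lemma take2_sub: "U \<subseteq> V \<Longrightarrow> take2 x U \<subseteq> V"
  by (auto simp: take2_def)

lemma finite_sub: "U \<subseteq> V \<Longrightarrow> finite U"
  using finite_V finite_subset by blast

text \<open>Comparing images instead of moves avoids matching vertices with points. The arbitrary
  \<open>h\<close> makes one equation serve for minimum, maximum and, with \<open>id\<close>, for
  the existence of a move.\<close>

lemma moves_eq:
  assumes "U \<subseteq> V"
  shows "(\<lambda>v. h (V - U \<union> open_nbhd V E v)) ` legal_moves V E (V - U)
       = (\<lambda>x. h (V - take2 x U)) ` {x. legal x U}"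
proof -
  have *: "V - U \<union> {x, \<sigma> x} = V - take2 x U" if "x \<in> V" for x
    using that sigma_V[OF that] assms by (auto simp: take2_def)
  have **: "(\<not> {x, \<sigma> x} \<subseteq> V - U) \<longleftrightarrow> legal x U" if "x \<in> V" for x
    using that sigma_V[OF that] by (auto simp: legal_def)
  have "(\<lambda>v. h (V - U \<union> open_nbhd V E v)) ` legal_moves V E (V - U)
      = (\<lambda>Y. h (V - U \<union> Y)) ` {Y \<in> open_nbhd V E ` V. \<not> Y \<subseteq> V - U}"
    by (auto simp: legal_moves_def)
  also have "\<dots> = (\<lambda>Y. h (V - U \<union> Y)) ` {Y \<in> (\<lambda>x. {x, \<sigma> x}) ` V. \<not> Y \<subseteq> V - U}"
    by (simp only: nbhds)
  also have "\<dots> = (\<lambda>x. h (V - U \<union> {x, \<sigma> x})) ` {x \<in> V. \<not> {x, \<sigma> x} \<subseteq> V - U}"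
    by blast
  also have "\<dots> = (\<lambda>x. h (V - take2 x U)) ` {x. legal x U}"
  proof (rule image_cong)
    show "{x \<in> V. \<not> {x, \<sigma> x} \<subseteq> V - U} = {x. legal x U}"
      using ** by (auto simp: legal_def)
  qed (use * in \<open>auto simp: legal_def\<close>)
  finally show ?thesis .
qed

lemma finite_legal: "finite {x. legal x U}"
  using finite_V by (auto simp: legal_def)

lemma legal_ex: "U \<subseteq> V \<Longrightarrow> U \<noteq> {} \<Longrightarrow> \<exists>x. legal x U"
  by (auto simp: legal_def)

lemma tg_value_step:
  assumes "U \<subseteq> V"
  shows "tg_value (Suc k) V E d (V - U) =
    (if U = {} then 0 else
     if d then Min ((\<lambda>x. Suc (tg_value k V E False (V - take2 x U))) ` {x. legal x U})
     else Max ((\<lambda>x. Suc (tg_value k V E True (V - take2 x U))) ` {x. legal x U}))"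
proof -
  have "legal_moves V E (V - U) = {} \<longleftrightarrow> U = {}"
    using moves_eq[OF assms, of id] legal_ex[OF assms] by (auto simp: legal_def)
  then show ?thesis
    using moves_eq[OF assms, of "\<lambda>D. Suc (tg_value k V E (\<not> d) D)"]
    by (cases d) (simp_all add: Let_def)
qed

lemma ub_mono: "ub d U b \<Longrightarrow> b \<le> c \<Longrightarrow> ub d U c"
  unfolding ub_def using order_trans by blast

lemma lb_mono: "lb d U b \<Longrightarrow> c \<le> b \<Longrightarrow> lb d U c"
  unfolding lb_def using order_trans by blast

lemma ub_empty: "ub d {} b"
  unfolding ub_def
proof
  fix k show "tg_value k V E d (V - {}) \<le> b"
    by (cases k) (use tg_value_step[of "{}"] in auto)
qed

text \<open>An upper bound needs one good move of Dominator and all moves of Staller; for a lower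
  bound the roles swap. In all four rules the separate \<open>c\<close> leaves room for rounding in
  divisions by 3.\<close>

lemma ub_D:
  assumes U: "U \<subseteq> V" and x: "legal x U" and b: "ub False (take2 x U) b" "Suc b \<le> c"
  shows "ub True U c"
  unfolding ub_def
proof
  fix k show "tg_value k V E True (V - U) \<le> c"
  proof (cases k)
    case (Suc j)
    have "U \<noteq> {}" using x by (auto simp: legal_def)
    then have "tg_value k V E True (V - U) \<le> Suc (tg_value j V E False (V - take2 x U))"
      unfolding Suc tg_value_step[OF U] using finite_legal x by (auto intro!: Min_le)
    also have "\<dots> \<le> c" using b unfolding ub_def by (meson Suc_le_mono order_trans)
    finally show ?thesis .
  qed simp
qed

lemma ub_S:
  assumes U: "U \<subseteq> V" "U \<noteq> {}" and b: "\<And>x. legal x U \<Longrightarrow> ub True (take2 x U) b" "Suc b \<le> c"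
  shows "ub False U c"
  unfolding ub_def
proof
  fix k show "tg_value k V E False (V - U) \<le> c"
  proof (cases k)
    case (Suc j)
    have "Suc (tg_value j V E True (V - take2 x U)) \<le> c" if "legal x U" for x
      using b(1)[OF that] b(2) unfolding ub_def by (meson Suc_le_mono order_trans)
    then show ?thesis
      unfolding Suc tg_value_step[OF U(1)] using finite_legal legal_ex[OF U] U(2) by auto
  qed simp
qed

lemma card_take2_less:
  assumes "U \<subseteq> V" "legal x U"
  shows "card (take2 x U) < card U"
  using assms finite_sub[of U]
  by (intro psubset_card_mono) (auto simp: legal_def take2_def)

lemma lb_S:
  assumes U: "U \<subseteq> V" and x: "legal x U" and b: "lb True (take2 x U) b" "c \<le> Suc b"
  shows "lb False U c"
  unfolding lb_def
proof (intro allI impI)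
  fix k assume k: "card U \<le> k"
  obtain j where j: "k = Suc j" "card (take2 x U) \<le> j"
    using k card_take2_less[OF U x] by (cases k) auto
  have "U \<noteq> {}" using x by (auto simp: legal_def)
  have "c \<le> Suc (tg_value j V E True (V - take2 x U))"
    using b j unfolding lb_def by (meson Suc_le_mono order_trans)
  also have "\<dots> \<le> tg_value k V E False (V - U)"
    unfolding j tg_value_step[OF U] using finite_legal x \<open>U \<noteq> {}\<close> by (auto intro!: Max_ge)
  finally show "c \<le> tg_value k V E False (V - U)" .
qed

lemma lb_D:
  assumes U: "U \<subseteq> V" "U \<noteq> {}" and b: "\<And>x. legal x U \<Longrightarrow> lb False (take2 x U) b" "c \<le> Suc b"
  shows "lb True U c"
  unfolding lb_def
proof (intro allI impI)
  fix k assume k: "card U \<le> k"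
  then obtain j where j: "k = Suc j"
    using U finite_sub[OF U(1)] by (cases k) auto
  have "c \<le> Suc (tg_value j V E False (V - take2 x U))" if "legal x U" for x
  proof -
    have "card (take2 x U) \<le> j" using k j card_take2_less[OF U(1) that] by simp
    then show ?thesis using b(1)[OF that] b(2) unfolding lb_def by (meson Suc_le_mono order_trans)
  qed
  then show "c \<le> tg_value k V E True (V - U)"
    unfolding j tg_value_step[OF U(1)] using finite_legal legal_ex[OF U] U(2) by auto
qed

section \<open>Effect of a move on points, ends and fresh orbits\<close>

lemma finite_Orbs: "finite Orbs"
  using orb_sub finite_V by (meson Pow_iff finite_Pow_iff finite_subset subsetI)

lemma finite_fresh: "finite (fresh U)"
  using finite_Orbs by (simp add: fresh_def)

lemma finite_ends: "U \<subseteq> V \<Longrightarrow> finite (ends U)"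
  using finite_sub by (auto simp: ends_def)

lemma fresh_take2: "fresh (take2 x U) \<subseteq> fresh U"
  by (auto simp: fresh_def take2_def)

lemma card_fresh_take2: "card (fresh (take2 x U)) \<le> card (fresh U)"
  by (simp add: card_mono finite_fresh fresh_take2)

text \<open>The move cuts off a last point, whose predecessor may become the new end, or a first
  point, which creates no end. A fresh orbit is missed because an invariant set contains both
  \<open>x\<close> and \<open>\<sigma> x\<close> or neither.\<close>

lemma single_move:
  assumes U: "U \<subseteq> V" and x: "x \<in> V" and xor: "x \<in> U \<longleftrightarrow> \<sigma> x \<notin> U"
  shows "card U = Suc (card (take2 x U))" "card (ends (take2 x U)) \<le> card (ends U)"
    "fresh (take2 x U) = fresh U" "A \<in> fresh U \<Longrightarrow> x \<notin> A \<and> \<sigma> x \<notin> A"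
proof -
  have fin: "finite U" using finite_sub U by blast
  show nin: "x \<notin> A \<and> \<sigma> x \<notin> A" if "A \<in> fresh U" for A
    using that orb_inv[of A x] x xor by (auto simp: fresh_def)
  then show "fresh (take2 x U) = fresh U"
    by (auto simp: fresh_def take2_def)
  show "card U = Suc (card (take2 x U))"
  proof (cases "x \<in> U")
    case True
    then have "take2 x U = U - {x}" using xor by (auto simp: take2_def)
    then show ?thesis using True fin by (metis card_Suc_Diff1)
  next
    case False
    then have "take2 x U = U - {\<sigma> x}" using xor by (auto simp: take2_def)
    then show ?thesis using False xor fin by (metis card_Suc_Diff1)
  qed
  show "card (ends (take2 x U)) \<le> card (ends U)"
  proof (cases "x \<in> U")
    case True
    obtain z where z: "z \<in> V" "\<sigma> z = x" using sigma_pre x by blast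
    have "ends (take2 x U) \<subseteq> insert z (ends U - {x})"
      using True xor U x z sigma_inj by (fastforce simp: ends_def take2_def)
    then have "card (ends (take2 x U)) \<le> card (insert z (ends U - {x}))"
      using finite_ends[OF U] by (intro card_mono) auto
    also have "\<dots> \<le> Suc (card (ends U - {x}))" by (rule card_insert_le_m1) (auto simp: card_insert_if)
    also have "\<dots> = card (ends U)"
      using True xor finite_ends[OF U] by (intro card_Suc_Diff1) (auto simp: ends_def)
    finally show ?thesis .
  next
    case False
    then have "ends (take2 x U) \<subseteq> ends U"
      using xor U x sigma_inj by (fastforce simp: ends_def take2_def)
    then show ?thesis using finite_ends[OF U] by (intro card_mono)
  qed
qed

text \<open>Only the predecessor of \<open>x\<close> can become an end. The last claim concerns a
  pair at the start of a run, where that predecessor is already missing.\<close>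

lemma double_move:
  assumes U: "U \<subseteq> V" and x: "x \<in> U" "\<sigma> x \<in> U"
  shows "card U = Suc (Suc (card (take2 x U)))" "card (ends (take2 x U)) \<le> Suc (card (ends U))"
    "A \<in> fresh U \<Longrightarrow> x \<in> A \<Longrightarrow> fresh (take2 x U) \<subseteq> fresh U - {A}"
    "z \<in> V \<Longrightarrow> z \<notin> U \<Longrightarrow> \<sigma> z = x \<Longrightarrow> card (ends (take2 x U)) \<le> card (ends U)"
proof -
  have fin: "finite U" using finite_sub U by blast
  have xV: "x \<in> V" using x U by auto
  have "take2 x U = U - {x} - {\<sigma> x}" by (auto simp: take2_def)
  moreover have "\<sigma> x \<in> U - {x}" using x no_fix[OF xV] by auto
  ultimately have "Suc (card (take2 x U)) = card (U - {x})"
    using fin by (metis card_Suc_Diff1 finite_Diff)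
  then show "card U = Suc (Suc (card (take2 x U)))"
    using x fin by (metis card_Suc_Diff1)
  obtain w where w: "w \<in> V" "\<sigma> w = x" using sigma_pre xV by blast
  have *: "ends (take2 x U) \<subseteq> insert w (ends U)"
    using U xV w sigma_inj by (fastforce simp: ends_def take2_def)
  then have "card (ends (take2 x U)) \<le> card (insert w (ends U))"
    using finite_ends[OF U] by (intro card_mono) auto
  also have "\<dots> \<le> Suc (card (ends U))" by (auto simp: card_insert_if finite_ends[OF U])
  finally show "card (ends (take2 x U)) \<le> Suc (card (ends U))" .
  show "fresh (take2 x U) \<subseteq> fresh U - {A}" if "A \<in> fresh U" "x \<in> A"
    using that by (auto simp: fresh_def take2_def)
  show "card (ends (take2 x U)) \<le> card (ends U)" if z: "z \<in> V" "z \<notin> U" "\<sigma> z = x"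
  proof -
    have "z = w" using sigma_inj z w by blast
    then have "ends (take2 x U) \<subseteq> ends U" using * z by (auto simp: ends_def take2_def)
    then show ?thesis using finite_ends[OF U] by (intro card_mono)
  qed
qed

text \<open>Opening a fresh orbit trades it for at most one run.\<close>

lemma double_fresh:
  assumes U: "U \<subseteq> V" and x: "x \<in> A" "A \<in> fresh U"
  shows "card U = Suc (Suc (card (take2 x U)))"
    "card (ends (take2 x U)) + card (fresh (take2 x U)) \<le> card (ends U) + card (fresh U)"
proof -
  have x': "x \<in> U" "\<sigma> x \<in> U"
    using x orb_inv[of A x] U by (auto simp: fresh_def)
  show "card U = Suc (Suc (card (take2 x U)))" by (rule double_move(1)[OF U x'])
  have "card (fresh (take2 x U)) \<le> card (fresh U - {A})"
    using double_move(3)[OF U x' x(2,1)] finite_fresh by (intro card_mono) auto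
  also have "Suc \<dots> = card (fresh U)" using x finite_fresh by (metis card_Suc_Diff1)
  finally show "card (ends (take2 x U)) + card (fresh (take2 x U)) \<le> card (ends U) + card (fresh U)"
    using double_move(2)[OF U x'] by linarith
qed

section \<open>Case distinctions and the general upper bound\<close>

lemma move_cases:
  assumes U: "U \<subseteq> V" and x: "legal x U"
  obtains (single) "x \<in> V" "x \<in> U \<longleftrightarrow> \<sigma> x \<notin> U"
  | (double) "x \<in> U" "\<sigma> x \<in> U"
  using x by (auto simp: legal_def)

text \<open>If no run starts with two points, the predecessor of a point of \<open>U\<close> that is
  no end lies in \<open>U\<close> and is no end either. Finiteness turns this inclusion into
  invariance.\<close>

lemma run_cases:
  assumes U: "U \<subseteq> V"
  obtains (long) z where "z \<in> V" "z \<notin> U" "\<sigma> z \<in> U" "\<sigma> (\<sigma> z) \<in> U"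
  | (short) "\<sigma> ` (U - ends U) = U - ends U"
proof (cases "\<exists>z\<in>V. z \<notin> U \<and> \<sigma> z \<in> U \<and> \<sigma> (\<sigma> z) \<in> U")
  case False
  let ?W = "U - ends U"
  have "?W \<subseteq> \<sigma> ` ?W"
  proof
    fix x assume x: "x \<in> ?W"
    then obtain z where z: "z \<in> V" "\<sigma> z = x" using sigma_pre U by blast
    then have "z \<in> ?W" using False x by (auto simp: ends_def)
    then show "x \<in> \<sigma> ` ?W" using z by auto
  qed
  moreover have "card (\<sigma> ` ?W) = card ?W"
    using bij U by (intro card_image) (auto simp: bij_betw_def intro: inj_on_subset)
  ultimately show ?thesis using short
    by (metis card_subset_eq finite_Diff finite_imageI finite_sub[OF U])
qed (use long in blast)

text \<open>Guarantees Staller a one-point move whenever points remain and nothing is fresh.\<close>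

lemma ends_empty:
  assumes U: "U \<subseteq> V" "U \<noteq> {}" "ends U = {}"
  shows "fresh U \<noteq> {}"
proof -
  have "\<sigma> ` U \<subseteq> U" using U by (auto simp: ends_def)
  moreover have "card (\<sigma> ` U) = card U"
    using bij U by (intro card_image) (auto simp: bij_betw_def intro: inj_on_subset)
  ultimately have "\<sigma> ` U = U" using finite_sub[OF U(1)] by (metis card_subset_eq)
  then show ?thesis using orb_min[OF U(1,2)] by (auto simp: fresh_def)
qed

lemma single_kill:
  assumes U: "U \<subseteq> V" and x: "x \<in> V" "x \<notin> U" "\<sigma> x \<in> U" "\<sigma> (\<sigma> x) \<notin> U"
  shows "Suc (card (ends (take2 x U))) = card (ends U)"
proof -
  have "ends (take2 x U) = ends U - {\<sigma> x}"
    using U x sigma_inj by (fastforce simp: ends_def take2_def)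
  moreover have "\<sigma> x \<in> ends U" using x by (auto simp: ends_def)
  ultimately show ?thesis using finite_ends[OF U] by (metis card_Suc_Diff1)
qed

text \<open>Let P be the numerator of the first bound. Each move of Staller lowers P by at least 2.
  Dominator can lower P by 4, by taking two points at the start of a run or by opening a fresh
  orbit, unless only isolated points remain. A round of two moves thus costs 6.\<close>

lemma upper:
  assumes "U \<subseteq> V"
  shows "ub True U ((2 * card U + card (ends U) + card (fresh U)) div 3) \<and>
         ub False U ((2 * card U + card (ends U) + card (fresh U) + 1) div 3)"
  using assms
proof (induction "card U" arbitrary: U rule: less_induct)
  case less
  note U = less.prems
  have IH: "ub True (take2 x U) ((2 * card (take2 x U) + card (ends (take2 x U)) + card (fresh (take2 x U))) div 3)"
      "ub False (take2 x U) ((2 * card (take2 x U) + card (ends (take2 x U)) + card (fresh (take2 x U)) + 1) div 3)"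
    if "legal x U" for x
    using less.hyps[OF card_take2_less[OF U that] take2_sub[OF U]] by auto
  show ?case
  proof (cases "U = {}")
    case True
    then show ?thesis by (simp add: ub_empty)
  next
    case ne: False
    have S: "ub False U ((2 * card U + card (ends U) + card (fresh U) + 1) div 3)"
    proof (rule ub_S[OF U ne])
      fix x assume x: "legal x U"
      show "ub True (take2 x U) ((2 * card U + card (ends U) + card (fresh U) - 2) div 3)"
        using U x
      proof (cases rule: move_cases)
        case single
        then show ?thesis
          using single_move[OF U single] by (intro ub_mono[OF IH(1)[OF x]] div_le_mono) auto
      next
        case double
        then show ?thesis
          using double_move(1,2)[OF U double] card_fresh_take2[of x U]
          by (intro ub_mono[OF IH(1)[OF x]] div_le_mono) auto
      qed
    next
      \<comment> \<open>Positivity makes the truncated subtraction of 2 exact.\<close>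
      have "card U > 0" using ne finite_sub[OF U] by (simp add: card_gt_0_iff)
      then show "Suc ((2 * card U + card (ends U) + card (fresh U) - 2) div 3)
         \<le> (2 * card U + card (ends U) + card (fresh U) + 1) div 3"
        by linarith
    qed
    have "ub True U ((2 * card U + card (ends U) + card (fresh U)) div 3)"
      using U
    proof (cases rule: run_cases)
      case (long z)
      let ?x = "\<sigma> z"
      have x: "legal ?x U" using long U by (auto simp: legal_def)
      show ?thesis
        using double_move(1)[OF U long(3,4)] double_move(4)[OF U long(3,4,1,2) refl] card_fresh_take2[of ?x U]
        by (intro ub_D[OF U x IH(2)[OF x]]) linarith
    next
      case short
      show ?thesis
      proof (cases "fresh U = {}")
        case True
        \<comment> \<open>The points that are not ends form an invariant set without an orbit
          inside, so there are none and all runs are single points. Taking one lowers the numerator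
          by only 3, but the numerator is \<open>3 * card U\<close>, and rounding makes up for the
          difference.\<close>
        have "ends U = U"
          using orb_min[OF _ _ short] True U by (force simp: fresh_def ends_def)
        obtain y where y: "y \<in> U" using ne by auto
        then obtain x where xV: "x \<in> V" "\<sigma> x = y" using sigma_pre U by blast
        have nU: "x \<notin> U" using xV y \<open>ends U = U\<close> by (auto simp: ends_def)
        have x: "legal x U" using xV y by (auto simp: legal_def)
        have "Suc (card (ends (take2 x U))) = card (ends U)"
          using single_kill[OF U xV(1) nU] xV y \<open>ends U = U\<close> by (auto simp: ends_def)
        then show ?thesis
          using single_move(1,3)[OF U xV(1)] nU xV y True \<open>ends U = U\<close>
          by (intro ub_D[OF U x IH(2)[OF x]]) auto
      next
        case False
        then obtain A where A: "A \<in> fresh U" by auto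
        then obtain x where xA: "x \<in> A" using orb_ne by (auto simp: fresh_def)
        have x: "legal x U" using A xA U by (auto simp: legal_def fresh_def)
        show ?thesis
          using double_fresh[OF U xA A]
          by (intro ub_D[OF U x IH(2)[OF x]]) linarith
      qed
    qed
    then show ?thesis using S by blast
  qed
qed

lemma upper_D: "U \<subseteq> V \<Longrightarrow> (2 * card U + card (ends U) + card (fresh U)) div 3 \<le> b \<Longrightarrow> ub True U b"
  using upper ub_mono by blast

lemma upper_S: "U \<subseteq> V \<Longrightarrow> (2 * card U + card (ends U) + card (fresh U) + 1) div 3 \<le> b \<Longrightarrow> ub False U b"
  using upper ub_mono by blast

section \<open>Sharper upper bounds with one fresh orbit\<close>

lemma fresh_single:
  assumes U: "U \<subseteq> V" and B: "fresh U = {B}"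
  shows "B \<subseteq> U" "B \<in> Orbs" "card U = card (U - B) + card B" "card B \<ge> 2"
proof -
  show BU: "B \<subseteq> U" and BO: "B \<in> Orbs" using B by (auto simp: fresh_def)
  show "card U = card (U - B) + card B"
    using BU finite_sub[OF U] by (metis add.commute card_Diff_subset card_mono finite_subset le_add_diff_inverse)
  obtain x where x: "x \<in> B" using orb_ne[OF BO] by auto
  then have "{x, \<sigma> x} \<subseteq> B" using orb_inv[OF BO] BU U by auto
  moreover have "card {x, \<sigma> x} = 2" using no_fix x BU U by (metis card_2_iff subsetD)
  ultimately show "card B \<ge> 2"
    using card_mono finite_sub BU U by (metis subset_trans)
qed

lemma fresh_legal_cases:
  assumes U: "U \<subseteq> V" and B: "fresh U = {B}" and x: "legal x U"
  obtains (single) "card U = Suc (card (take2 x U))" "card (ends (take2 x U)) \<le> card (ends U)"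
      "fresh (take2 x U) = {B}" "card (U - B) = Suc (card (take2 x U - B))"
  | (double) "card U = Suc (Suc (card (take2 x U)))" "card (ends (take2 x U)) \<le> Suc (card (ends U))"
      "fresh (take2 x U) = {B}" "card (U - B) = Suc (Suc (card (take2 x U - B)))"
  | (opened) "card U = Suc (Suc (card (take2 x U)))" "fresh (take2 x U) = {}"
      "card (ends (take2 x U)) \<le> Suc (card (ends U))"
  using U x
proof (cases rule: move_cases)
  case s: single
  have "fresh (take2 x U) = {B}" using single_move(3)[OF U s] B by simp
  then show ?thesis
    using single_move(1,2)[OF U s] fresh_single(3)[OF U B] fresh_single(3)[OF take2_sub[OF U], of x B]
    by (intro single) auto
next
  case d: double
  show ?thesis
  proof (cases "x \<in> B")
    case True
    have "fresh (take2 x U) = {}" using double_move(3)[OF U d _ True] B by auto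
    then show ?thesis using opened double_move(1,2)[OF U d] by blast
  next
    case False
    then have "\<sigma> x \<notin> B" using orb_inv[of B x] B d U by (auto simp: fresh_def)
    then have "B \<in> fresh (take2 x U)" using False B by (auto simp: fresh_def take2_def)
    then have "fresh (take2 x U) = {B}" using fresh_take2[of x U] B by auto
    then show ?thesis
      using double_move(1,2)[OF U d] fresh_single(3)[OF U B] fresh_single(3)[OF take2_sub[OF U], of x B]
      by (intro double) auto
  qed
qed

text \<open>Ends lie outside \<open>B\<close>, so \<open>ne\<close> provides a point outside
  \<open>B\<close> that is no end. If no run started with two points, such points would form an
  invariant set and contain a second fresh orbit.\<close>

lemma long_run:
  assumes U: "U \<subseteq> V" and B: "fresh U = {B}" and ne: "card (U - B) \<noteq> card (ends U)"
  obtains x where "legal x U" "card U = Suc (Suc (card (take2 x U)))"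
    "card (ends (take2 x U)) \<le> card (ends U)" "fresh (take2 x U) = {B}"
    "card (U - B) = Suc (Suc (card (take2 x U - B)))"
  using U
proof (cases rule: run_cases)
  case (long z)
  let ?x = "\<sigma> z"
  have "z \<notin> B" using B long by (auto simp: fresh_def)
  then have n: "?x \<notin> B" using B orb_inv[of B z] long by (auto simp: fresh_def)
  then have "\<sigma> ?x \<notin> B" using B orb_inv[of B "?x"] long U by (auto simp: fresh_def)
  then have "B \<in> fresh (take2 ?x U)" using n B by (auto simp: fresh_def take2_def)
  then have f: "fresh (take2 ?x U) = {B}" using fresh_take2[of ?x U] B by auto
  have "legal ?x U" using long U by (auto simp: legal_def)
  then show ?thesis
    using that[of ?x] f double_move(1)[OF U long(3,4)] double_move(4)[OF U long(3,4,1,2) refl]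
      fresh_single(3)[OF U B] fresh_single(3)[OF take2_sub[OF U] f] by simp
next
  case short
  have BO: "B \<in> Orbs" "B \<subseteq> U" using B by (auto simp: fresh_def)
  have BE: "ends U \<subseteq> U - B" using BO U orb_inv[OF BO(1)] by (auto simp: ends_def)
  let ?W = "U - B - ends U"
  have "\<sigma> ` ?W \<subseteq> ?W"
  proof
    fix y assume "y \<in> \<sigma> ` ?W"
    then obtain x where x: "x \<in> ?W" "y = \<sigma> x" by auto
    then have "y \<in> U - ends U" using short by auto
    moreover have "y \<notin> B" using x U orb_inv[OF BO(1)] by auto
    ultimately show "y \<in> ?W" by auto
  qed
  moreover have "card (\<sigma> ` ?W) = card ?W"
    using bij U by (intro card_image) (auto simp: bij_betw_def intro: inj_on_subset)
  ultimately have "\<sigma> ` ?W = ?W" using finite_sub[OF U] by (metis card_subset_eq finite_Diff)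
  moreover have "\<not> (\<exists>A\<in>Orbs. A \<subseteq> ?W)"
  proof
    assume "\<exists>A\<in>Orbs. A \<subseteq> ?W"
    then obtain A where A: "A \<in> Orbs" "A \<subseteq> ?W" by auto
    then have "A \<in> fresh U" by (auto simp: fresh_def)
    then show False using B A orb_ne[OF A(1)] by blast
  qed
  ultimately have "?W = {}" using orb_min[of ?W] U by blast
  then have "ends U = U - B" using BE by auto
  then show ?thesis using ne by simp
qed

text \<open>The fresh orbit no longer adds 1 to the numerator of \<open>upper\<close>. The
  incongruence ensures that some run outside \<open>B\<close> has two points for Dominator to take.
  If Staller then takes one point and the number of ends is unchanged, three points are gone and the
  incongruence persists. After any other course of the round the general bound suffices.\<close>

lemma upper_fresh_mod:
  assumes "U \<subseteq> V" "fresh U = {B}" "card (U - B) mod 3 \<noteq> card (ends U) mod 3"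
  shows "ub True U ((2 * card U + card (ends U)) div 3)"
  using assms
proof (induction "card U" arbitrary: U rule: less_induct)
  case less
  note U = less.prems(1) and B = less.prems(2)
  obtain x where x: "legal x U" and x1: "card U = Suc (Suc (card (take2 x U)))"
    "card (ends (take2 x U)) \<le> card (ends U)" and f: "fresh (take2 x U) = {B}"
    and x2: "card (U - B) = Suc (Suc (card (take2 x U - B)))"
    using long_run[OF U B] less.prems(3) by metis
  let ?U = "take2 x U"
  have U': "?U \<subseteq> V" by (rule take2_sub[OF U])
  have big: "card ?U \<ge> 2" using fresh_single(3,4)[OF U' f] by simp
  have "ub False ?U ((2 * card U + card (ends U)) div 3 - 1)"
  proof (cases "card (ends ?U) = card (ends U)")
    case False
    then show ?thesis using x1 f big by (intro upper_S U') simp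
  next
    case True
    show ?thesis
    proof (rule ub_S[OF U'])
      show "?U \<noteq> {}" using big by auto
    next
      show "Suc ((2 * card U + card (ends U)) div 3 - 2) \<le> (2 * card U + card (ends U)) div 3 - 1"
        using big x1 by linarith
    next
      fix y assume y: "legal y ?U"
      let ?T = "take2 y ?U"
      have T: "?T \<subseteq> V" by (rule take2_sub[OF U'])
      show "ub True ?T ((2 * card U + card (ends U)) div 3 - 2)"
        using U' f y
      proof (cases rule: fresh_legal_cases)
        case single
        show ?thesis
        proof (cases "card (ends ?T) = card (ends U)")
          case eq: True
          have "card (U - B) = card (?T - B) + 3" using x2 single by simp
          then have "ub True ?T ((2 * card ?T + card (ends ?T)) div 3)"
            using x1 single eq less.prems(3)
            by (intro less.hyps T single) auto
          then show ?thesis by (rule ub_mono) (use x1 single eq in linarith)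
        next
          case False
          then show ?thesis using x1 single by (intro upper_D T) simp
        qed
      next
        case double
        then show ?thesis using x1 by (intro upper_D T) simp
      next
        case opened
        then show ?thesis using x1 by (intro upper_D T) simp
      qed
    qed
  qed
  then show ?case by (rule ub_D[OF U x]) (use x1 big in linarith)
qed

text \<open>Handles a single run whose length is 1 modulo 3, where \<open>upper_fresh_mod\<close>
  fails. Dominator takes two points of the run and Staller one, which preserves the residue, until
  Dominator takes its last point and Staller has to open \<open>B\<close>. Deviations of Staller are
  covered by \<open>upper\<close>.\<close>

lemma upper_fresh_run:
  assumes "U \<subseteq> V" "fresh U = {B}" "card (ends U) \<le> 1" "card (U - B) mod 3 = 1"
  shows "ub True U ((2 * card U + 1) div 3)"
  using assms
proof (induction "card U" arbitrary: U rule: less_induct)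
  case less
  note U = less.prems(1) and B = less.prems(2) and fs = fresh_single[OF U B]
  show ?case
  proof (cases "card (U - B) = 1")
    case True
    then obtain y where y: "U - B = {y}" by (auto simp: card_1_singleton_iff)
    have yV: "y \<in> V" using y U by auto
    \<comment> \<open>The predecessor \<open>x\<close> of the only point outside \<open>B\<close> is
      not in \<open>U\<close>, so the move named by \<open>x\<close> leaves exactly
      \<open>B\<close>, and every reply opens it.\<close>
    obtain x where x: "x \<in> V" "\<sigma> x = y" using sigma_pre[OF yV] by blast
    have BO: "B \<in> Orbs" by (rule fs(2))
    have xU: "x \<notin> U"
    proof
      assume "x \<in> U"
      then consider "x \<in> B" | "x = y" using y by blast
      then show False
      proof cases
        case 1
        then have "y \<in> B" using orb_inv[OF BO x(1)] x(2) by simp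
        then show False using y by blast
      next
        case 2
        then show False using no_fix[OF x(1)] x(2) by simp
      qed
    qed
    have lx: "legal x U" using x y by (auto simp: legal_def)
    have tU: "take2 x U = B" using y xU x fs(1) by (auto simp: take2_def)
    have BV: "B \<subseteq> V" and fB: "fresh B = {B}"
      using tU take2_sub[OF U] single_move(3)[OF U x(1)] xU x y B by auto
    have eB: "ends B = {}" using orb_inv[OF BO] BV by (auto simp: ends_def)
    have cB: "card U = Suc (card B)" "card B \<ge> 2" using fs True by auto
    have "ub False B ((2 * card U + 1) div 3 - 1)"
    proof (rule ub_S[OF BV])
      show "B \<noteq> {}" using orb_ne[OF BO] .
      show "Suc ((2 * card U + 1) div 3 - 2) \<le> (2 * card U + 1) div 3 - 1"
        using cB by linarith
      fix z assume z: "legal z B"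
      show "ub True (take2 z B) ((2 * card U + 1) div 3 - 2)"
        using BV fB z
      proof (cases rule: fresh_legal_cases)
        case opened
        then show ?thesis using cB eB by (intro upper_D take2_sub BV) simp
      qed auto
    qed
    then show ?thesis using tU cB by (intro ub_D[OF U lx]) auto
  next
    case False
    then have ne: "card (U - B) \<noteq> card (ends U)" using less.prems by auto
    obtain x where x: "legal x U" and x1: "card U = Suc (Suc (card (take2 x U)))"
      "card (ends (take2 x U)) \<le> card (ends U)" and f: "fresh (take2 x U) = {B}"
      and x2: "card (U - B) = Suc (Suc (card (take2 x U - B)))"
      using long_run[OF U B ne] by metis
    let ?U = "take2 x U"
    have U': "?U \<subseteq> V" by (rule take2_sub[OF U])
    have big: "card ?U \<ge> 2" using fresh_single(3,4)[OF U' f] by simp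
    have "ub False ?U ((2 * card U + 1) div 3 - 1)"
    proof (rule ub_S[OF U'])
      show "?U \<noteq> {}" using big by auto
      show "Suc ((2 * card U + 1) div 3 - 2) \<le> (2 * card U + 1) div 3 - 1"
        using big x1 by linarith
      fix y assume y: "legal y ?U"
      let ?T = "take2 y ?U"
      have T: "?T \<subseteq> V" by (rule take2_sub[OF U'])
      show "ub True ?T ((2 * card U + 1) div 3 - 2)"
        using U' f y
      proof (cases rule: fresh_legal_cases)
        case single
        have "card (U - B) = card (?T - B) + 3" using x2 single by simp
        then have "ub True ?T ((2 * card ?T + 1) div 3)"
          using x1 single less.prems by (intro less.hyps T single) auto
        then show ?thesis by (rule ub_mono) (use x1 single in linarith)
      next
        case double
        then show ?thesis using x1 less.prems(3) by (intro upper_D T) simp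
      next
        case opened
        then show ?thesis using x1 less.prems(3) by (intro upper_D T) simp
      qed
    qed
    then show ?thesis by (rule ub_D[OF U x]) (use x1 big in linarith)
  qed
qed

text \<open>Here \<open>card U\<close> is \<open>3 * q + 2\<close> and the bound
  \<open>2 * q + 1\<close> is one less than \<open>upper\<close> gives. Dominator answers each
  one-point move by two points from the run, preserving the residue 0, so that Staller is the one to
  open \<open>B\<close> unless the run is split earlier.\<close>

lemma upper_fresh_staller:
  assumes "U \<subseteq> V" "fresh U = {B}" "card (ends U) \<le> 1" "card (U - B) mod 3 = 0" "card B mod 3 = 2"
  shows "ub False U ((2 * card U - 1) div 3)"
  using assms
proof (induction "card U" arbitrary: U rule: less_induct)
  case less
  note U = less.prems(1) and B = less.prems(2) and fs = fresh_single[OF U B]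
  have "card U mod 3 = 2" using less.prems(4,5) fs(3) by presburger
  then obtain q where q: "card U = 3 * q + 2" by (metis mult_div_mod_eq)
  show ?case
  proof (rule ub_S[OF U])
    show "U \<noteq> {}" using orb_ne fs by auto
    show "Suc (2 * q) \<le> (2 * card U - 1) div 3" using q by linarith
    fix x assume x: "legal x U"
    let ?U = "take2 x U"
    have U': "?U \<subseteq> V" by (rule take2_sub[OF U])
    show "ub True ?U (2 * q)"
      using U B x
    proof (cases rule: fresh_legal_cases)
      case single
      \<comment> \<open>At least two points outside \<open>B\<close> with at most one end: a
        two-point answer exists.\<close>
      have m2: "card (?U - B) mod 3 = 2" using single(4) less.prems(4) by (simp add: mod3_Suc)
      have "card (?U - B) \<noteq> card (ends ?U)"
      proof
        assume "card (?U - B) = card (ends ?U)"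
        then have "card (?U - B) \<le> 1" using single(2) less.prems(3) by linarith
        then show False using m2 by simp
      qed
      then obtain y where y: "legal y ?U" and y1: "card ?U = Suc (Suc (card (take2 y ?U)))"
        "card (ends (take2 y ?U)) \<le> card (ends ?U)" and f: "fresh (take2 y ?U) = {B}"
        and y2: "card (?U - B) = Suc (Suc (card (take2 y ?U - B)))"
        using long_run[OF U' single(3)] by metis
      have T: "take2 y ?U \<subseteq> V" by (rule take2_sub[OF U'])
      have "ub False (take2 y ?U) ((2 * card (take2 y ?U) - 1) div 3)"
      proof (rule less.hyps[OF _ T f])
        show "card (take2 y ?U) < card U" using single y1 by simp
        show "card (ends (take2 y ?U)) \<le> 1" using single y1 less.prems(3) by simp
        show "card (take2 y ?U - B) mod 3 = 0"
          using single(4) y2 less.prems(4) by (simp add: mod3_Suc)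
      qed (rule less.prems(5))
      moreover have "Suc ((2 * card (take2 y ?U) - 1) div 3) \<le> 2 * q"
        using single(1) y1(1) q fresh_single(3,4)[OF T f] by linarith
      ultimately show ?thesis by (rule ub_D[OF U' y])
    next
      case double
      show ?thesis
      proof (cases "card (ends ?U) = 2")
        case True
        \<comment> \<open>After a split there are two ends but 1 modulo 3 points outside
          \<open>B\<close>, the incongruence required by \<open>upper_fresh_mod\<close>.\<close>
        have "card (?U - B) mod 3 = 1" using double(4) less.prems(4) by (simp add: mod3_Suc)
        then have "ub True ?U ((2 * card ?U + card (ends ?U)) div 3)"
          using True by (intro upper_fresh_mod[OF U' double(3)]) simp
        moreover have "(2 * card ?U + card (ends ?U)) div 3 \<le> 2 * q"
          using double(1) q True by linarith
        ultimately show ?thesis by (rule ub_mono)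
      next
        case False
        have "card (ends ?U) \<le> 1" using double(2) less.prems(3) False by linarith
        moreover have "card (fresh ?U) = 1" using double(3) by simp
        ultimately show ?thesis using double(1) q by (intro upper_D[OF U']) linarith
      qed
    next
      case opened
      have "card (ends ?U) \<le> 2" using opened less.prems(3) by simp
      moreover have "card (fresh ?U) = 0" using opened(2) by simp
      ultimately show ?thesis using opened(1) q by (intro upper_D[OF U']) linarith
    qed
  qed
qed

section \<open>Staller's lower bounds\<close>

lemma single_ex:
  assumes U: "U \<subseteq> V" "ends U \<noteq> {}"
  obtains x where "x \<in> V" "x \<in> U" "\<sigma> x \<notin> U" "legal x U"
  using U that by (auto simp: ends_def legal_def)

lemma card_take2_cases:
  assumes "U \<subseteq> V" "legal x U"
  obtains "card U = Suc (card (take2 x U))" | "card U = Suc (Suc (card (take2 x U)))"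
  using assms by (cases rule: move_cases) (use single_move(1) double_move(1) assms in blast)+

text \<open>Without fresh orbits Staller can always cut off one end, while Dominator removes at most
  two points, so a round of two moves uses up at most three points.\<close>

lemma lower:
  assumes "U \<subseteq> V" "fresh U = {}"
  shows "lb True U ((2 * card U + 1) div 3) \<and> lb False U ((2 * card U + 2) div 3)"
  using assms
proof (induction "card U" arbitrary: U rule: less_induct)
  case less
  note U = less.prems(1)
  have f: "fresh (take2 x U) = {}" for x using fresh_take2[of x U] less.prems(2) by auto
  have IH: "lb True (take2 x U) ((2 * card (take2 x U) + 1) div 3)"
      "lb False (take2 x U) ((2 * card (take2 x U) + 2) div 3)"
    if "legal x U" for x
    using less.hyps[OF card_take2_less[OF U that] take2_sub[OF U] f] by auto
  show ?case
  proof (cases "U = {}")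
    case True
    then show ?thesis by (simp add: lb_def)
  next
    case ne: False
    then have pos: "card U > 0" using finite_sub[OF U] by (simp add: card_gt_0_iff)
    have "lb True U ((2 * card U + 1) div 3)"
    proof (rule lb_D[OF U ne])
      show "(2 * card U + 1) div 3 \<le> Suc ((2 * card U - 2) div 3)" using pos by linarith
      fix x assume x: "legal x U"
      show "lb False (take2 x U) ((2 * card U - 2) div 3)"
        using U x by (cases rule: card_take2_cases) (auto intro!: lb_mono[OF IH(2)[OF x]] div_le_mono)
    qed
    moreover have "lb False U ((2 * card U + 2) div 3)"
    proof -
      obtain x where x: "x \<in> V" "x \<in> U" "\<sigma> x \<notin> U" and lx: "legal x U"
        using ends_empty[OF U ne] less.prems(2) single_ex[OF U] by metis
      have "card U = Suc (card (take2 x U))" using single_move(1)[OF U x(1)] x by simp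
      then show ?thesis by (intro lb_S[OF U lx IH(1)[OF lx]]) linarith
    qed
    ultimately show ?thesis by blast
  qed
qed

text \<open>The correction 2 is charged for the residues at which play outside \<open>B\<close>, two
  points by Dominator and one by Staller in turn, leaves Staller with \<open>B\<close> alone. A
  one-point move of Dominator keeps 2 more in the numerator, which pays for a correction arising
  then; once \<open>B\<close> is opened, \<open>lower\<close> applies.\<close>

lemma lower_fresh:
  assumes "U \<subseteq> V" "fresh U = {B}"
  shows "lb True U ((2 * card U + 1 - (if card (U - B) mod 3 = 2 then 2 else 0)) div 3) \<and>
    lb False U ((2 * card U + 2 - (if card (U - B) mod 3 = 0 then 2 else 0)) div 3)"
  using assms
proof (induction "card U" arbitrary: U rule: less_induct)
  case less
  note U = less.prems(1) and B = less.prems(2) and fs = fresh_single[OF U B]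
  have ne: "U \<noteq> {}" using fs orb_ne by auto
  have IH: "lb True (take2 x U) ((2 * card (take2 x U) + 1 - (if card (take2 x U - B) mod 3 = 2 then 2 else 0)) div 3)"
      "lb False (take2 x U) ((2 * card (take2 x U) + 2 - (if card (take2 x U - B) mod 3 = 0 then 2 else 0)) div 3)"
    if "legal x U" "fresh (take2 x U) = {B}" for x
    using less.hyps[OF card_take2_less[OF U that(1)] take2_sub[OF U] that(2)] by auto
  have "lb True U ((2 * card U + 1 - (if card (U - B) mod 3 = 2 then 2 else 0)) div 3)" (is "lb _ _ ?b")
  proof (rule lb_D[OF U ne])
    show "?b \<le> Suc (?b - 1)" by simp
    fix x assume x: "legal x U"
    show "lb False (take2 x U) (?b - 1)"
      using U B x
    proof (cases rule: fresh_legal_cases)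
      case single
      then show ?thesis by (intro lb_mono[OF IH(2)[OF x single(3)]]) auto
    next
      case double
      have "card (take2 x U - B) mod 3 = 0 \<longleftrightarrow> card (U - B) mod 3 = 2" using double(4) by (simp add: mod3_Suc)
      then show ?thesis using double(1) by (intro lb_mono[OF IH(2)[OF x double(3)]]) auto
    next
      case opened
      have "lb False (take2 x U) ((2 * card (take2 x U) + 2) div 3)"
        using lower[OF take2_sub[OF U] opened(2)] by blast
      then show ?thesis by (rule lb_mono) (use opened(1) in auto)
    qed
  qed
  moreover have "lb False U ((2 * card U + 2 - (if card (U - B) mod 3 = 0 then 2 else 0)) div 3)"
  proof (cases "ends U = {}")
    case True
    have "\<sigma> ` U \<subseteq> U" using True by (auto simp: ends_def)
    \<comment> \<open>Points outside \<open>B\<close> without ends would contain another fresh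
      orbit. So Staller must take two points of \<open>B\<close>, and the correction for residue 0
      accounts for the extra one.\<close>
    have UB: "U - B = {}"
    proof (rule ccontr)
      assume n: "U - B \<noteq> {}"
      have "B \<in> Orbs" using fs by simp
      then have "ends (U - B) = {}" using True orb_inv U by (fastforce simp: ends_def)
      then obtain A where "A \<in> fresh (U - B)" using ends_empty[of "U - B"] n U by blast
      then have "A \<in> fresh U" "A \<noteq> B" using orb_ne by (auto simp: fresh_def)
      then show False using B by auto
    qed
    obtain x where xB: "x \<in> B" using orb_ne fs by auto
    have x: "legal x U" using xB fs U by (auto simp: legal_def)
    have "B \<in> fresh U" using B by simp
    then have c: "card U = Suc (Suc (card (take2 x U)))" by (rule double_fresh(1)[OF U xB])
    have "fresh (take2 x U) = {}"
      using fresh_take2[of x U] B xB by (auto simp: fresh_def take2_def)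
    then have "lb True (take2 x U) ((2 * card (take2 x U) + 1) div 3)"
      using lower[OF take2_sub[OF U]] by blast
    moreover have "card (U - B) mod 3 = 0" unfolding UB by simp
    ultimately show ?thesis using c by (intro lb_S[OF U x]) auto
  next
    case False
    obtain x where x: "x \<in> V" "x \<in> U" "\<sigma> x \<notin> U" and lx: "legal x U"
      using False single_ex[OF U] by metis
    have f: "fresh (take2 x U) = {B}" using single_move(3)[OF U x(1)] x B by simp
    have c: "card U = Suc (card (take2 x U))" using single_move(1)[OF U x(1)] x by simp
    then have c': "card (U - B) = Suc (card (take2 x U - B))"
      using fs(3) fresh_single(3)[OF take2_sub[OF U] f] by simp
    then have "card (take2 x U - B) mod 3 = 2 \<longleftrightarrow> card (U - B) mod 3 = 0" by (simp add: mod3_Suc)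
    then show ?thesis using c by (intro lb_S[OF U lx IH(1)[OF lx f]]) auto
  qed
  ultimately show ?case by blast
qed

section \<open>Start positions with one or two orbits\<close>

lemma gamma_tg_le: "ub True V b \<Longrightarrow> gamma_tg V E \<le> b"
  unfolding ub_def gamma_tg_def by simp

lemma gamma_tg_ge: "lb True V b \<Longrightarrow> b \<le> gamma_tg V E"
  unfolding lb_def gamma_tg_def by simp

lemma Diff_Diff_point: "v \<in> V \<Longrightarrow> V - (V - {v}) = {v}"
  by auto

lemma gamma_tg_pd_le: "v \<in> V \<Longrightarrow> ub True (V - {v}) b \<Longrightarrow> gamma_tg_pd V E v \<le> b"
  unfolding ub_def gamma_tg_pd_def Diff_Diff_point by blast

lemma gamma_tg_pd_ge: "v \<in> V \<Longrightarrow> lb True (V - {v}) b \<Longrightarrow> b \<le> gamma_tg_pd V E v"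
  unfolding lb_def gamma_tg_pd_def Diff_Diff_point by (simp add: card_Diff1_le)

lemma ends_V: "ends V = {}"
  using sigma_V by (auto simp: ends_def)

lemma ends_delete:
  assumes v: "v \<in> V"
  shows "card (ends (V - {v})) \<le> 1"
proof -
  obtain w where w: "w \<in> V" "\<sigma> w = v" using sigma_pre v by blast
  have "ends (V - {v}) \<subseteq> {w}" using w sigma_inj sigma_V by (fastforce simp: ends_def)
  then have "card (ends (V - {v})) \<le> card {w}" by (intro card_mono) auto
  then show ?thesis by simp
qed

text \<open>Initially there are no ends and one fresh orbit, which gives the upper bound. The first
  move must take two points and open the orbit, after which \<open>lower\<close> applies.\<close>

lemma gamma_tg_one_orbit:
  assumes O: "Orbs = {V}"
  shows "gamma_tg V E = (2 * card V + 1) div 3"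
proof (rule antisym)
  have f: "fresh V = {V}" unfolding fresh_def using O by auto
  show "gamma_tg V E \<le> (2 * card V + 1) div 3"
    by (intro gamma_tg_le upper_D) (simp_all add: f ends_V)
  have "lb True V ((2 * card V + 1) div 3)"
  proof (rule lb_D)
    show "V \<noteq> {}" using O orb_ne by auto
    have "card V \<ge> 2" using fresh_single(4)[OF subset_refl f] .
    then show "(2 * card V + 1) div 3 \<le> Suc ((2 * card V - 2) div 3)" by linarith
    fix x assume x: "legal x V"
    then have "x \<in> V" by (simp add: legal_def)
    then have "card V = Suc (Suc (card (take2 x V)))"
      using double_fresh(1)[OF subset_refl, of x V] f by simp
    moreover have "fresh (take2 x V) = {}"
      unfolding fresh_def take2_def using O \<open>x \<in> V\<close> by auto
    ultimately show "lb False (take2 x V) ((2 * card V - 2) div 3)"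
      using lower[OF take2_sub[OF subset_refl]] by simp
  qed simp
  then show "(2 * card V + 1) div 3 \<le> gamma_tg V E" by (rule gamma_tg_ge)
qed

text \<open>Removing \<open>v\<close> leaves nothing fresh and at most one end, where
  \<open>upper\<close> and \<open>lower\<close> meet.\<close>

lemma gamma_tg_pd_one_orbit:
  assumes O: "Orbs = {V}" and v: "v \<in> V"
  shows "gamma_tg_pd V E v = (2 * card V - 1) div 3"
proof (rule antisym)
  have f: "fresh (V - {v}) = {}" unfolding fresh_def using O v by auto
  have c: "card V = Suc (card (V - {v}))" using v finite_V by (metis card_Suc_Diff1)
  show "gamma_tg_pd V E v \<le> (2 * card V - 1) div 3"
    using ends_delete[OF v] by (intro gamma_tg_pd_le v upper_D) (auto simp: f c intro!: div_le_mono)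
  show "(2 * card V - 1) div 3 \<le> gamma_tg_pd V E v"
    using lower[OF Diff_subset f] by (intro gamma_tg_pd_ge v) (simp add: c)
qed

lemma two_orbits_open:
  assumes O: "Orbs = {A, B}" "A \<inter> B = {}" "A \<union> B = V" and x: "x \<in> A"
  shows "card V = Suc (Suc (card (take2 x V)))" "fresh (take2 x V) = {B}"
    "card A = Suc (Suc (card (take2 x V - B)))" "card (ends (take2 x V)) \<le> 1"
    "legal x V"
proof -
  have xV: "x \<in> V" "\<sigma> x \<in> V" using x O sigma_V by auto
  have sA: "\<sigma> x \<in> A" using x xV O orb_inv by auto
  show "legal x V" using xV by (simp add: legal_def)
  show c: "card V = Suc (Suc (card (take2 x V)))"
    using double_move(1)[OF subset_refl xV] .
  show "card (ends (take2 x V)) \<le> 1" using double_move(2)[OF subset_refl xV] ends_V by simp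
  show f: "fresh (take2 x V) = {B}" unfolding fresh_def take2_def using O x sA by auto
  have "card V = card A + card B"
    using O finite_V by (metis card_Un_disjoint finite_Un)
  then show "card A = Suc (Suc (card (take2 x V - B)))"
    using fresh_single(3)[OF take2_sub[OF subset_refl] f] c by simp
qed

lemma two_orbits_delete:
  assumes O: "Orbs = {A, B}" "A \<inter> B = {}" "A \<union> B = V" and v: "v \<in> A"
  shows "card V = Suc (card (V - {v}))" "fresh (V - {v}) = {B}" "card A = Suc (card (V - {v} - B))"
proof -
  have vV: "v \<in> V" using v O by auto
  show c: "card V = Suc (card (V - {v}))" using vV finite_V by (metis card_Suc_Diff1)
  show f: "fresh (V - {v}) = {B}" unfolding fresh_def using O v by auto
  have "card V = card A + card B"
    using O finite_V by (metis card_Un_disjoint finite_Un)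
  then show "card A = Suc (card (V - {v} - B))"
    using fresh_single(3)[OF Diff_subset f] c by simp
qed

text \<open>Any first move leaves \<open>3 * q - 2\<close> points of the opened orbit, nonzero
  modulo 3, so \<open>lower_fresh\<close> charges no correction.\<close>

lemma two_orbits_lower:
  assumes O: "Orbs = {A, B}" "A \<inter> B = {}" "A \<union> B = V" and m: "card A = 3 * q" "card B = 3 * q"
  shows "4 * q \<le> gamma_tg V E"
proof (rule gamma_tg_ge, rule lb_D)
  \<comment> \<open>Stated for arbitrary \<open>A\<close> and \<open>B\<close>, to cover a first
    move in either orbit.\<close>
  have "lb False (take2 x V) (4 * q - 1)"
    if "Orbs = {A, B}" "A \<inter> B = {}" "A \<union> B = V" "x \<in> A" "card A = 3 * q" "card B = 3 * q" for x A B
  proof -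
    note o = two_orbits_open[OF that(1-4)]
    have "card V = 3 * q + 3 * q" using that finite_V by (metis card_Un_disjoint finite_Un)
    then have "(2 * card (take2 x V) + 2) div 3 \<ge> 4 * q - 1" using o(1) by linarith
    moreover have "Suc (Suc (card (take2 x V - B))) mod 3 = 0" using o(3) that(5) by (metis mod_mult_self1_is_0)
    then have "card (take2 x V - B) mod 3 \<noteq> 0" by (simp add: mod3_Suc)
    then have "lb False (take2 x V) ((2 * card (take2 x V) + 2) div 3)"
      using lower_fresh[OF take2_sub[OF subset_refl] o(2)] by simp
    ultimately show ?thesis by (metis lb_mono)
  qed
  note * = this
  have O': "Orbs = {B, A}" "B \<inter> A = {}" "B \<union> A = V" using O by auto
  show "lb False (take2 x V) (4 * q - 1)" if "legal x V" for x
    using *[OF O _ m] *[OF O' _ m(2,1)] that O(3) unfolding legal_def by blast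
  show "V \<noteq> {}" using O orb_ne by auto
  show "4 * q \<le> Suc (4 * q - 1)" by linarith
qed simp

text \<open>Without \<open>v\<close> there are \<open>3 * q - 1\<close> points outside
  \<open>B\<close>, 2 modulo 3, and at most one end, so \<open>upper_fresh_mod\<close>
  applies.\<close>

lemma two_orbits_pd_upper:
  assumes O: "Orbs = {A, B}" "A \<inter> B = {}" "A \<union> B = V" and m: "card A = 3 * q" "card B = 3 * q"
    and v: "v \<in> A"
  shows "gamma_tg_pd V E v < 4 * q"
proof -
  note d = two_orbits_delete[OF O v]
  have vV: "v \<in> V" using v O by auto
  have n: "card V = 3 * q + 3 * q" using O m finite_V by (metis card_Un_disjoint finite_Un)
  have "Suc (card (V - {v} - B)) mod 3 = 0" using d(3) m by (metis mod_mult_self1_is_0)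
  then have "card (V - {v} - B) mod 3 = 2" by (simp add: mod3_Suc)
  then have "ub True (V - {v}) ((2 * card (V - {v}) + card (ends (V - {v}))) div 3)"
    using ends_delete[OF vV] by (intro upper_fresh_mod[OF Diff_subset d(2)]) auto
  moreover have "(2 * card (V - {v}) + card (ends (V - {v}))) div 3 \<le> 4 * q - 1"
    using d(1) n ends_delete[OF vV] by linarith
  ultimately have "gamma_tg_pd V E v \<le> 4 * q - 1" using gamma_tg_pd_le[OF vV] ub_mono by blast
  \<comment> \<open>Here \<open>d(3)\<close> supplies \<open>q > 0\<close>, needed for
    \<open>4 * q - 1 < 4 * q\<close>.\<close>
  then show ?thesis using d(3) m by linarith
qed

text \<open>Dominator opens \<open>A\<close>. For \<open>r = 2\<close> this leaves
  \<open>3 * q\<close> points outside \<open>B\<close>, the situation of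
  \<open>upper_fresh_staller\<close>. For \<open>r = 1\<close> it leaves \<open>3 * q - 1\<close>,
  and a one-point reply leads to the residue 1 of \<open>upper_fresh_run\<close>.\<close>

lemma two_orbits_upper:
  assumes O: "Orbs = {A, B}" "A \<inter> B = {}" "A \<union> B = V"
    and m: "card A = 3 * q + r" "card B = 3 * q + r" "r = 1 \<or> r = 2"
  shows "gamma_tg V E \<le> 4 * q + r"
proof -
  obtain x where x: "x \<in> A" using O orb_ne by auto
  note o = two_orbits_open[OF O x]
  have n: "card V = (3 * q + r) + (3 * q + r)" using O m finite_V by (metis card_Un_disjoint finite_Un)
  let ?U = "take2 x V"
  have U: "?U \<subseteq> V" by (rule take2_sub) simp
  \<comment> \<open>Excludes \<open>q = 0\<close> with \<open>r = 1\<close>, so the subtractions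
    below are exact.\<close>
  have m2: "2 \<le> 3 * q + r" using fresh_single(4)[OF U o(2)] m by simp
  have "ub False ?U (4 * q + r - 1)"
    using m(3)
  proof
    assume r: "r = 2"
    have "card (?U - B) = 3 * q" using o(3) m(1) r by simp
    then have "ub False ?U ((2 * card ?U - 1) div 3)"
      using m(2) r o(4) by (intro upper_fresh_staller[OF U o(2)]) (auto simp: mod3_Suc)
    moreover have "(2 * card ?U - 1) div 3 \<le> 4 * q + r - 1" using n o(1) r by linarith
    ultimately show ?thesis by (rule ub_mono)
  next
    assume r: "r = 1"
    show ?thesis
    proof (rule ub_S[OF U])
      show "?U \<noteq> {}" using fresh_single(1,2)[OF U o(2)] orb_ne by blast
      show "Suc (4 * q + r - 2) \<le> 4 * q + r - 1" using m2 r by linarith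
      fix y assume y: "legal y ?U"
      let ?T = "take2 y ?U"
      have T: "?T \<subseteq> V" by (rule take2_sub[OF U])
      show "ub True ?T (4 * q + r - 2)"
        using U o(2) y
      proof (cases rule: fresh_legal_cases)
        case single
        \<comment> \<open>The opening took two points of \<open>A\<close> and the reply took
          one.\<close>
        have "Suc (Suc (Suc (card (?T - B)))) mod 3 = Suc 0"
          using single(4) o(3) m(1) r by (metis One_nat_def mod_mult_self4 mod_less one_less_numeral_iff semiring_norm(77))
        then have "card (?T - B) mod 3 = 1" by (simp add: mod3_Suc)
        then have "ub True ?T ((2 * card ?T + 1) div 3)"
          using single(2,3) o(4) by (intro upper_fresh_run[OF T single(3)]) auto
        moreover have "(2 * card ?T + 1) div 3 \<le> 4 * q + r - 2"
          using single(1) o(1) n r by linarith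
        ultimately show ?thesis by (rule ub_mono)
      next
        case double
        have "card (fresh ?T) = 1" using double(3) by simp
        then show ?thesis using double(1,2) o(1,4) n r by (intro upper_D[OF T]) linarith
      next
        case opened
        have "card (fresh ?T) = 0" using opened(2) by simp
        then show ?thesis using opened(1,3) o(1,4) n r by (intro upper_D[OF T]) linarith
      qed
    qed
  qed
  then have "ub True V (4 * q + r)" by (rule ub_D[OF subset_refl o(5)]) (use m2 in linarith)
  then show ?thesis by (rule gamma_tg_le)
qed

text \<open>There remain \<open>3 * q + r - 1\<close> points outside \<open>B\<close>, of residue 0
  or 1, and \<open>lower_fresh\<close> charges Dominator's turn only at residue 2.\<close>

lemma two_orbits_pd_lower:
  assumes O: "Orbs = {A, B}" "A \<inter> B = {}" "A \<union> B = V"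
    and m: "card A = 3 * q + r" "card B = 3 * q + r" "r = 1 \<or> r = 2"
    and v: "v \<in> A"
  shows "4 * q + r \<le> gamma_tg_pd V E v"
proof -
  note d = two_orbits_delete[OF O v]
  have vV: "v \<in> V" using v O by auto
  have n: "card V = (3 * q + r) + (3 * q + r)" using O m finite_V by (metis card_Un_disjoint finite_Un)
  have "card (V - {v} - B) = 3 * q + (r - 1)" using d(3) m by linarith
  then have "card (V - {v} - B) mod 3 \<noteq> 2" using m(3) by auto
  then have "lb True (V - {v}) ((2 * card (V - {v}) + 1) div 3)"
    using lower_fresh[OF Diff_subset d(2)] by simp
  then have "(2 * card (V - {v}) + 1) div 3 \<le> gamma_tg_pd V E v" by (rule gamma_tg_pd_ge[OF vV])
  moreover have "4 * q + r \<le> (2 * card (V - {v}) + 1) div 3" using m(3) n d(1) by (elim disjE) linarith+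
  ultimately show ?thesis by linarith
qed

lemma critical_one_orbit:
  assumes O: "Orbs = {V}"
  shows "tg_critical V E \<longleftrightarrow> card V mod 3 \<noteq> 2"
proof -
  have "card V > 0" using O orb_ne finite_V by (simp add: card_gt_0_iff)
  then have "(2 * card V - 1) div 3 < (2 * card V + 1) div 3 \<longleftrightarrow> card V mod 3 \<noteq> 2"
    by (rule thirds_less_iff)
  moreover have "V \<noteq> {}" using O orb_ne by auto
  ultimately show ?thesis
    unfolding tg_critical_def gamma_tg_one_orbit[OF O] using gamma_tg_pd_one_orbit[OF O] by auto
qed

text \<open>For residues 1 and 2 the number \<open>4 * q + r\<close> is at least
  \<open>gamma_tg V E\<close> and at most \<open>gamma_tg_pd V E v\<close>, so one \<open>v\<close>
  refutes criticality. For residue 0 the number \<open>4 * q\<close> separates the values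
  strictly.\<close>

lemma critical_two_orbits:
  assumes O: "Orbs = {A, B}" "A \<inter> B = {}" "A \<union> B = V" and m: "card A = m" "card B = m"
  shows "tg_critical V E \<longleftrightarrow> m mod 3 = 0"
proof
  define q r where "q = m div 3" and "r = m mod 3"
  have m': "card A = 3 * q + r" "card B = 3 * q + r" using m by (simp_all add: q_def r_def)
  assume c: "tg_critical V E"
  obtain v where v: "v \<in> A" using O orb_ne by auto
  then have "gamma_tg_pd V E v < gamma_tg V E" using c O unfolding tg_critical_def by blast
  then have "\<not> (r = 1 \<or> r = 2)"
    using two_orbits_pd_lower[OF O m' _ v] two_orbits_upper[OF O m'] by fastforce
  moreover have "r < 3" by (simp add: r_def)
  ultimately show "m mod 3 = 0" unfolding r_def by linarith
next
  assume "m mod 3 = 0"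
  then obtain q where q: "m = 3 * q" by auto
  have O': "Orbs = {B, A}" "B \<inter> A = {}" "B \<union> A = V" using O by auto
  note m' = m[unfolded q]
  have "gamma_tg_pd V E v < 4 * q" if "v \<in> V" for v
    using that two_orbits_pd_upper[OF O m'] two_orbits_pd_upper[OF O' m'(2,1)] O(3) by blast
  then show "tg_critical V E"
    using two_orbits_lower[OF O m'] unfolding tg_critical_def by (meson less_le_trans)
qed

end

section \<open>The cycle as an orbit game\<close>

lemma mod_add_inj:
  fixes n :: nat
  assumes "x < n" "y < n" "(x + k) mod n = (y + k) mod n"
  shows "x = y"
proof -
  have "a = b" if "a < n" "b < n" "(a + k) mod n = (b + k) mod n" "b \<le> a" for a b
  proof -
    have "n dvd (a + k) - (b + k)" using that by (subst mod_eq_dvd_iff_nat[symmetric]) auto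
    then have "n dvd a - b" by simp
    then show ?thesis using that nat_dvd_not_less[of "a - b" n] by fastforce
  qed
  then show ?thesis using assms nat_le_linear by metis
qed

lemma bij_shift: "bij_betw (\<lambda>x. (x + k) mod n) {0..<n} {0..<n::nat}"
proof -
  have "inj_on (\<lambda>x. (x + k) mod n) {0..<n}" by (auto intro!: inj_onI dest: mod_add_inj)
  moreover have "(\<lambda>x. (x + k) mod n) ` {0..<n} \<subseteq> {0..<n}" by auto
  ultimately show ?thesis by (simp add: bij_betw_def endo_inj_surj)
qed

text \<open>The pair at \<open>x\<close> is the neighbourhood of \<open>(x + 1) mod n\<close>, and
  the shift by 1 permutes the vertices.\<close>

lemma cycle_nbhds:
  "open_nbhd {0..<n} (cycle_adj n) ` {0..<n} = (\<lambda>x. {x, (x + 2) mod n}) ` {0..<n}"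
proof -
  have "open_nbhd {0..<n} (cycle_adj n) ((x + 1) mod n) = {x, (x + 2) mod n}" if "x < n" for x
  proof -
    have "((x + 1) mod n + 1) mod n = (x + 2) mod n" by (simp add: mod_simps)
    then show ?thesis
      using that mod_add_inj[of x n _ 1] by (auto simp: open_nbhd_def cycle_adj_def)
  qed
  then have "(\<lambda>x. open_nbhd {0..<n} (cycle_adj n) ((x + 1) mod n)) ` {0..<n}
      = (\<lambda>x. {x, (x + 2) mod n}) ` {0..<n}"
    by (intro image_cong) auto
  moreover have "(\<lambda>x. (x + 1) mod n) ` {0..<n} = {0..<n}"
    using bij_shift[of 1 n] by (simp add: bij_betw_def)
  ultimately show ?thesis by (metis image_image)
qed

lemma shift2_reach:
  fixes n :: nat
  assumes W: "W \<subseteq> {0..<n}" "(\<lambda>x. (x + 2) mod n) ` W = W" and x: "x \<in> W" and y: "y < n"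
    and par: "odd n \<or> even (x + y)"
  shows "y \<in> W"
proof -
  have xn: "x < n" using W x by auto
  have step: "(x + 2 * k) mod n \<in> W" for k
  proof (induction k)
    case 0
    then show ?case using x xn by simp
  next
    case (Suc k)
    have "((x + 2 * k) mod n + 2) mod n = (x + 2 * Suc k) mod n" by (simp add: mod_simps)
    then show ?case using Suc W(2) by (metis imageI)
  qed
  \<comment> \<open>One of \<open>y + n - x\<close> and \<open>y + 2 * n - x\<close> is even: for
    odd n they differ in parity, for even n the first is even by \<open>par\<close>. Adding n before
    subtracting avoids truncation.\<close>
  have "\<exists>k j. x + 2 * k = y + j * n"
  proof (cases "even (y + n - x)")
    case True
    then have "x + 2 * ((y + n - x) div 2) = y + 1 * n" using xn by simp
    then show ?thesis by blast
  next
    case False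
    then have "even (y + 2 * n - x)" using par xn by (auto simp: even_diff_nat)
    then have "x + 2 * ((y + 2 * n - x) div 2) = y + 2 * n" using xn by simp
    then show ?thesis by blast
  qed
  then obtain k j where "x + 2 * k = y + j * n" by blast
  then show ?thesis using step[of k] y by simp
qed

lemma cycle_orbit_game_odd:
  assumes n: "n \<ge> 3" "odd n"
  shows "orbit_game {0..<n} (cycle_adj n) (\<lambda>x. (x + 2) mod n) {{0..<n}}"
proof
  show "bij_betw (\<lambda>x. (x + 2) mod n) {0..<n} {0..<n}" by (rule bij_shift)
  show "(x + 2) mod n \<noteq> x" if "x \<in> {0..<n}" for x
    using that n by (auto simp: mod_if)
  show "\<exists>A\<in>{{0..<n}}. A \<subseteq> W"
    if "W \<subseteq> {0..<n}" "W \<noteq> {}" "(\<lambda>x. (x + 2) mod n) ` W = W" for W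
    using that n shift2_reach[OF that(1,3)] by auto
qed (use n in \<open>auto simp: cycle_nbhds\<close>)

lemma cycle_orbit_game_even:
  assumes n: "n \<ge> 3" "even n"
  shows "orbit_game {0..<n} (cycle_adj n) (\<lambda>x. (x + 2) mod n) {{x. x < n \<and> even x}, {x. x < n \<and> odd x}}"
proof
  show "bij_betw (\<lambda>x. (x + 2) mod n) {0..<n} {0..<n}" by (rule bij_shift)
  show "(x + 2) mod n \<noteq> x" if "x \<in> {0..<n}" for x
    using that n by (auto simp: mod_if)
  show "\<exists>A\<in>{{x. x < n \<and> even x}, {x. x < n \<and> odd x}}. A \<subseteq> W"
    if W: "W \<subseteq> {0..<n}" "W \<noteq> {}" "(\<lambda>x. (x + 2) mod n) ` W = W" for W
  proof -
    obtain x where x: "x \<in> W" using W by auto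
    then show ?thesis using shift2_reach[OF W(1,3) x] by (cases "even x") auto
  qed
  show "A \<noteq> {}" if "A \<in> {{x. x < n \<and> even x}, {x. x < n \<and> odd x}}" for A
  proof -
    have "0 \<in> {x. x < n \<and> even x}" "1 \<in> {x. x < n \<and> odd x}" using n by auto
    then show ?thesis using that by blast
  qed
  show "(x + 2) mod n \<in> A \<longleftrightarrow> x \<in> A"
    if "A \<in> {{x. x < n \<and> even x}, {x. x < n \<and> odd x}}" "x \<in> {0..<n}" for A x
  proof -
    have "even ((x + 2) mod n) \<longleftrightarrow> even x" using n by (simp add: dvd_mod_iff)
    then show ?thesis using that by auto
  qed
qed (auto simp: cycle_nbhds)

theorem theorem2p1:
  fixes n :: nat
  assumes "n \<ge> 3"
  shows "tg_critical {0..<n} (cycle_adj n) \<longleftrightarrow> n mod 6 \<in> {0, 1, 3}"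
proof (cases "odd n")
  case True
  interpret orbit_game "{0..<n}" "cycle_adj n" "\<lambda>x. (x + 2) mod n" "{{0..<n}}"
    by (rule cycle_orbit_game_odd[OF assms True])
  \<comment> \<open>An odd n is 1, 3 or 5 modulo 6, and only 5 is 2 modulo 3.\<close>
  have "n mod 3 \<noteq> 2 \<longleftrightarrow> n mod 6 \<in> {0, 1, 3}" using True by auto presburger+
  then show ?thesis using critical_one_orbit by simp
next
  case False
  then obtain m where m: "n = 2 * m" by auto
  let ?A = "{x. x < n \<and> even x}" and ?B = "{x. x < n \<and> odd x}"
  interpret orbit_game "{0..<n}" "cycle_adj n" "\<lambda>x. (x + 2) mod n" "{?A, ?B}"
    by (rule cycle_orbit_game_even[OF assms]) (use False in simp)
  have "?A = (\<lambda>i. 2 * i) ` {0..<m}"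
    using m by (auto elim!: evenE)
  moreover have "?B = (\<lambda>i. 2 * i + 1) ` {0..<m}"
    using m by (auto elim!: oddE)
  ultimately have "card ?A = m" "card ?B = m"
    by (simp_all add: card_image inj_on_def)
  then have "tg_critical {0..<n} (cycle_adj n) \<longleftrightarrow> m mod 3 = 0"
    by (intro critical_two_orbits[OF refl]) auto
  also have "\<dots> \<longleftrightarrow> n mod 6 \<in> {0, 1, 3}" unfolding m by auto presburger+
  finally show ?thesis .
qed

end
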